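(* Let $\alpha,\gamma,\kappa,\delta,\bar S>0$, let $\beta=1$, and suppose $\alpha<\alpha_2:=2\gamma+\kappa\bar S/(\delta+\kappa)$ (so that the optimal policy does not reach full automation). Let $V$ be the value function, $u^*$ the optimal usage policy (which for $\beta=1$ does not depend on skill), and $\hat S=\bar S(1-u^* )$ the steady-state skill under $u^*$. Define $$\alpha_0:=\frac{\kappa\bar S}{\delta+\kappa},\qquad \alpha_1:=\frac{(2\delta+\kappa)\bar S}{\delta+\kappa}.$$ Then: 1. If $\alpha\le\alpha_0$, AI is not adopted ($u^*=0$) and $V(\hat S)=\bar S/\delta$. 2. If $\alpha_0<\alpha<\alpha_1$, the optimal policy satisfies $0<u^*<1$ and raises current productivity, but lowers long-run value below the no-AI benchmark: $V(\hat S)<\bar S/\delta$. At $\alpha=\alpha_1$ adoption breaks even: $V(\hat S)=\bar S/\delta$. 3. If $\alpha>\alpha_1$, AI adoption (with $0<u^*<1$) improves both short-run productivity and long-run value: $V(\hat S)>\bar S/\delta$.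
   Context: A worker has skill $S_t\in[0,\bar S]$; a decision-maker chooses AI usage $u_t\in[0,1]$. Flow productivity is $p(S,u)=(1-u)S+[\alpha+\beta S-\gamma u]u$. Skill evolves by $\dot S_t=\kappa\bar S(1-u_t)-\kappa S_t$. The value function is $$V(S_0)=\max_{u_t\in[0,1]}\int_0^\infty e^{-\delta t}p(S_t,u_t)\,dt,$$ with Bellman equation $\delta V(S)=\max_{u\in[0,1]}\{p(S,u)+V'(S)[\kappa\bar S(1-u)-\kappa S]\}$; $u^*$ denotes the maximizing usage. The no-AI benchmark is $\bar S/\delta$ (the discounted output of working at full skill $\bar S$ without AI). "Raises current (short-run) productivity" means $p(S,u^* )>p(S,0)=S$ at the current skill $S$. *)

theory Defs
  imports "HOL-Analysis.Analysis"
begin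

definition productivity :: "real \<Rightarrow> real \<Rightarrow> real \<Rightarrow> real \<Rightarrow> real \<Rightarrow> real" where
  "productivity \<alpha> \<beta> \<gamma> S u = (1 - u) * S + (\<alpha> + \<beta> * S - \<gamma> * u) * u"

definition skill_drift :: "real \<Rightarrow> real \<Rightarrow> real \<Rightarrow> real \<Rightarrow> real" where
  "skill_drift \<kappa> Sbar S u = \<kappa> * Sbar * (1 - u) - \<kappa> * S"

text \<open>
  Controls are arbitrary Lebesgue measurable functions on the half-line with values in the
  unit interval. Since they may be discontinuous, the differential equation for the skill is
  read in the sense of Caratheodory, i.e. as an integral equation; the case \<open>t = 0\<close> gives the
  initial condition \<open>S 0 = S0\<close>. For \<open>S0\<close> in \<open>{0..Sbar}\<close> every such path stays in \<open>{0..Sbar}\<close>,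
  so that no state constraint is imposed.
\<close>

definition admissible ::
  "real \<Rightarrow> real \<Rightarrow> real \<Rightarrow> (real \<Rightarrow> real) \<Rightarrow> (real \<Rightarrow> real) \<Rightarrow> bool" where
  "admissible \<kappa> Sbar S0 u S \<longleftrightarrow>
     u \<in> borel_measurable (lebesgue_on {0..}) \<and>
     (\<forall>t\<ge>0. u t \<in> {0..1}) \<and>
     (\<forall>t\<ge>0. ((\<lambda>s. skill_drift \<kappa> Sbar (S s) (u s)) has_integral (S t - S0)) {0..t})"

text \<open>
  For admissible pairs the integrand below is bounded by a multiple of \<open>exp (- \<delta> * t)\<close>, so that
  the integral exists and coincides with the Lebesgue integral.
\<close>

definition payoff ::
  "real \<Rightarrow> real \<Rightarrow> real \<Rightarrow> real \<Rightarrow> (real \<Rightarrow> real) \<Rightarrow> (real \<Rightarrow> real) \<Rightarrow> real" where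
  "payoff \<alpha> \<beta> \<gamma> \<delta> u S =
     integral {0..} (\<lambda>t. exp (- \<delta> * t) * productivity \<alpha> \<beta> \<gamma> (S t) (u t))"

definition value_fun ::
  "real \<Rightarrow> real \<Rightarrow> real \<Rightarrow> real \<Rightarrow> real \<Rightarrow> real \<Rightarrow> real \<Rightarrow> real" where
  "value_fun \<alpha> \<beta> \<gamma> \<kappa> \<delta> Sbar S0 =
     Sup {payoff \<alpha> \<beta> \<gamma> \<delta> u S | u S. admissible \<kappa> Sbar S0 u S}"

text \<open>
  The maximum in the control problem is attained at \<open>u\<close> (the path \<open>S\<close> is determined by \<open>u\<close> and
  \<open>S0\<close> for \<open>t \<ge> 0\<close>).
\<close>

definition optimal_control ::
  "real \<Rightarrow> real \<Rightarrow> real \<Rightarrow> real \<Rightarrow> real \<Rightarrow> real \<Rightarrow> real \<Rightarrow> (real \<Rightarrow> real) \<Rightarrow> bool" where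
  "optimal_control \<alpha> \<beta> \<gamma> \<kappa> \<delta> Sbar S0 u \<longleftrightarrow>
     (\<exists>S. is_arg_max (\<lambda>(v, T). payoff \<alpha> \<beta> \<gamma> \<delta> v T) (\<lambda>(v, T). admissible \<kappa> Sbar S0 v T) (u, S))"

text \<open>
  The Bellman equation holds at skill \<open>S\<close> and its maximum is attained at usage \<open>u\<close>. The value
  function is only considered on \<open>{0..Sbar}\<close>, hence the one-sided derivatives at the endpoints.
\<close>

definition bellman_usage ::
  "real \<Rightarrow> real \<Rightarrow> real \<Rightarrow> real \<Rightarrow> real \<Rightarrow> real \<Rightarrow> real \<Rightarrow> real \<Rightarrow> bool" where
  "bellman_usage \<alpha> \<beta> \<gamma> \<kappa> \<delta> Sbar S u \<longleftrightarrow>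
     (\<exists>D. (value_fun \<alpha> \<beta> \<gamma> \<kappa> \<delta> Sbar has_real_derivative D) (at S within {0..Sbar}) \<and>
          is_arg_max (\<lambda>v. productivity \<alpha> \<beta> \<gamma> S v + D * skill_drift \<kappa> Sbar S v)
            (\<lambda>v. v \<in> {0..1}) u \<and>
          \<delta> * value_fun \<alpha> \<beta> \<gamma> \<kappa> \<delta> Sbar S =
            productivity \<alpha> \<beta> \<gamma> S u + D * skill_drift \<kappa> Sbar S u)"

end

theory Submission imports Defs begin

text \<open>
  For \<open>\<beta> = 1\<close> productivity is \<open>S + \<alpha> * u - \<gamma> * u\<^sup>2\<close>, so the problem is linear in the skill.
  Integrating the derivative of \<open>exp (- \<delta> * t) * S t\<close> over the half-line expresses the discounted
  skill through the discounted usage, and the payoff becomes an affine function of \<open>S0\<close> plus the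
  discounted integral of \<open>a * u - \<gamma> * u\<^sup>2\<close> with \<open>a = \<alpha> - \<kappa> * Sbar / (\<delta> + \<kappa>)\<close>. This is maximized
  pointwise by the constant usage \<open>max 0 (a / (2 * \<gamma>))\<close>, which gives \<open>V\<close> in closed form. At the steady
  state, \<open>V\<close> exceeds \<open>Sbar / \<delta>\<close> by \<open>ustar / (2 * \<delta>) * (\<alpha> - \<alpha>1)\<close>.
\<close>

section \<open>Integration by parts against an indefinite integral\<close>

text \<open>Dividing the bound by the length of the interval leaves a difference quotient of size at
  most \<open>K * \<bar>y - x\<bar>\<close>. Hence \<open>h\<close> has derivative 0 at every point
  of the interval, with no exceptional set.\<close>

lemma quadratic_increments_imp_constant:
  fixes h :: "real \<Rightarrow> real"
  assumes "a \<le> b"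
    and bound: "\<And>s t. a \<le> s \<Longrightarrow> s \<le> t \<Longrightarrow> t \<le> b \<Longrightarrow> \<bar>h t - h s\<bar> \<le> K * (t - s)\<^sup>2"
  shows "h b = h a"
proof -
  have "(h has_field_derivative 0) (at x within {a..b})" if x: "x \<in> {a..b}" for x
    unfolding has_field_derivative_iff
  proof (rule Lim_null_comparison)
    show "\<forall>\<^sub>F y in at x within {a..b}. norm ((h y - h x) / (y - x)) \<le> K * \<bar>y - x\<bar>"
      unfolding eventually_at_filter
    proof (intro always_eventually allI impI)
      fix y assume y: "y \<noteq> x" "y \<in> {a..b}"
      have "\<bar>h y - h x\<bar> \<le> K * (y - x)\<^sup>2"
      proof (cases "x \<le> y")
        case True
        then show ?thesis using bound x y by auto
      next
        case False
        then have "\<bar>h x - h y\<bar> \<le> K * (x - y)\<^sup>2" using bound x y by auto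
        then show ?thesis by (simp add: abs_minus_commute power2_commute)
      qed
      then have "\<bar>h y - h x\<bar> \<le> K * \<bar>y - x\<bar> * \<bar>y - x\<bar>"
        by (simp add: power2_eq_square mult.assoc)
      then show "norm ((h y - h x) / (y - x)) \<le> K * \<bar>y - x\<bar>"
        using y by (simp add: pos_divide_le_eq)
    qed
    show "((\<lambda>y. K * \<bar>y - x\<bar>) \<longlongrightarrow> 0) (at x within {a..b})"
      by (auto intro!: tendsto_eq_intros)
  qed
  then obtain c where "\<forall>x\<in>{a..b}. h x = c"
    using has_field_derivative_zero_constant[of "{a..b}" h] by auto
  then show ?thesis using \<open>a \<le> b\<close> by auto
qed

text \<open>
  The function \<open>g\<close> is only bounded and integrable, so its indefinite integral \<open>G\<close> need not be
  differentiable off a countable set, as the library's rules for integration by parts require.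
  The two sides still differ by \<open>O((t - s)\<^sup>2)\<close> on \<open>{s..t}\<close>.
\<close>
lemma has_integral_by_parts_indefinite:
  fixes w w' g G :: "real \<Rightarrow> real"
  assumes "a \<le> b"
    and w: "\<And>t. t \<in> {a..b} \<Longrightarrow> (w has_real_derivative w' t) (at t within {a..b})"
    and w': "continuous_on {a..b} w'"
    and G: "\<And>t. t \<in> {a..b} \<Longrightarrow> (g has_integral (G t - c)) {a..t}"
    and B: "\<And>t. t \<in> {a..b} \<Longrightarrow> \<bar>g t\<bar> \<le> B"
  shows "((\<lambda>t. w t * g t + w' t * G t) has_integral (w b * G b - w a * c)) {a..b}"
proof -
  let ?f = "\<lambda>t. w t * g t + w' t * G t"
  obtain L where L: "\<And>t. t \<in> {a..b} \<Longrightarrow> \<bar>w' t\<bar> \<le> L"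
  proof -
    have "bounded (w' ` {a..b})"
      using compact_continuous_image[OF w'] compact_imp_bounded by auto
    then show ?thesis using that unfolding bounded_iff by (metis imageI real_norm_def)
  qed
  have L0: "0 \<le> L" using L[of a] \<open>a \<le> b\<close> by auto
  have B0: "0 \<le> B" using B[of a] \<open>a \<le> b\<close> by auto
  have gint: "g integrable_on {s..t}" if "a \<le> s" "t \<le> b" for s t
  proof (rule integrable_subinterval_real)
    show "g integrable_on {a..b}" using G[of b] \<open>a \<le> b\<close> by auto
  qed (use that in auto)
  have gst: "(g has_integral (G t - G s)) {s..t}" if "a \<le> s" "s \<le> t" "t \<le> b" for s t
  proof -
    have "integral {a..s} g + integral {s..t} g = integral {a..t} g"
      using that by (intro Henstock_Kurzweil_Integration.integral_combine gint) auto
    moreover have "integral {a..s} g = G s - c" "integral {a..t} g = G t - c"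
      using G[of s] G[of t] that by (auto intro: integral_unique)
    ultimately show ?thesis
      using gint[of s t] that by (auto simp: has_integral_iff)
  qed
  have lipG: "\<bar>G t - G s\<bar> \<le> B * (t - s)" if "a \<le> s" "s \<le> t" "t \<le> b" for s t
    using has_integral_bound_real[OF B0 finite.emptyI gst[OF that]] B that by auto
  have lipw: "\<bar>w t - w s\<bar> \<le> L * (t - s)" if "a \<le> s" "s \<le> t" "t \<le> b" for s t
    using field_differentiable_bound[of "{a..b}" w w' L s t] w L that by auto
  have contw: "continuous_on {a..b} w"
    using w by (meson DERIV_continuous continuous_on_eq_continuous_within)
  have contG: "continuous_on {a..b} G"
  proof -
    have "continuous_on {a..b} (\<lambda>t. c + integral {a..t} g)"
      by (intro continuous_intros indefinite_integral_continuous_1 gint) auto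
    moreover have "c + integral {a..t} g = G t" if "t \<in> {a..b}" for t
      using integral_unique[OF G[OF that]] by simp
    ultimately show ?thesis by (rule continuous_on_eq)
  qed
  \<comment> \<open>Gauge integrability alone does not survive products. Since \<open>g\<close> is
    bounded it is absolutely integrable, and this is preserved by the bounded measurable factor
    \<open>w\<close>.\<close>
  have "(\<lambda>t. w t * g t) absolutely_integrable_on {a..b}"
  proof (rule absolutely_integrable_bounded_measurable_product_real)
    show "w \<in> borel_measurable (lebesgue_on {a..b})"
      using contw by (intro continuous_imp_measurable_on_sets_lebesgue) auto
    show "bounded (w ` {a..b})"
      using compact_continuous_image[OF contw] compact_imp_bounded by auto
    show "g absolutely_integrable_on {a..b}"
      using B by (intro absolutely_integrable_integrable_bound[where g = "\<lambda>_. B"] gint) auto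
  qed auto
  then have fint: "?f integrable_on {a..b}"
    by (intro integrable_add integrable_continuous_real continuous_intros w' contG
        set_lebesgue_integral_eq_integral(1))
  \<comment> \<open>\<open>h\<close> is the defect of the formula on \<open>{a..t}\<close>. Its
    value at \<open>a\<close> is \<open>w a * G a\<close> with \<open>G a = c\<close>, so constancy
    of \<open>h\<close> is the claim.\<close>
  define h where "h t = w t * G t - integral {a..t} ?f" for t
  have "h b = h a"
  proof (rule quadratic_increments_imp_constant[OF \<open>a \<le> b\<close>])
    fix s t assume st: "a \<le> s" "s \<le> t" "t \<le> b"
    have fst: "?f integrable_on {s..t}"
      using integrable_subinterval_real[OF fint] st by auto
    have "integral {a..s} ?f + integral {s..t} ?f = integral {a..t} ?f"
      using st by (intro Henstock_Kurzweil_Integration.integral_combine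
          integrable_subinterval_real[OF fint]) auto
    then have ht: "h t - h s = w t * G t - w s * G s - integral {s..t} ?f"
      by (simp add: h_def)
    have wst: "(w' has_integral (w t - w s)) {s..t}"
    proof (rule fundamental_theorem_of_calculus)
      fix x assume "x \<in> {s..t}"
      then have "(w has_real_derivative w' x) (at x within {s..t})"
        using w[of x] st DERIV_subset[of w "w' x" x "{a..b}" "{s..t}"] by auto
      then show "(w has_vector_derivative w' x) (at x within {s..t})"
        by (simp add: has_real_derivative_iff_has_vector_derivative)
    qed (use st in auto)
    \<comment> \<open>The increment of \<open>w * G\<close> is split as
      \<open>w t * (G t - G s) + G s * (w t - w s)\<close>, and both differences are integrals over
      \<open>{s..t}\<close>. After subtracting \<open>?f\<close>, each term of the integrand has a
      factor \<open>w t - w r\<close> or \<open>G s - G r\<close>, which is O(t - s) by the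
      Lipschitz bounds. Integrating over an interval of length \<open>t - s\<close> gives the second
      power.\<close>
    have "((\<lambda>r. w t * g r + G s * w' r - ?f r) has_integral
        (w t * (G t - G s) + G s * (w t - w s) - integral {s..t} ?f)) {s..t}"
      by (intro has_integral_diff has_integral_add has_integral_mult_right gst wst
          integrable_integral fst st)
    then have "((\<lambda>r. (w t - w r) * g r + w' r * (G s - G r)) has_integral (h t - h s)) {s..t}"
      unfolding ht by (simp add: algebra_simps)
    moreover have "norm ((w t - w r) * g r + w' r * (G s - G r)) \<le> 2 * L * B * (t - s)"
      if r: "r \<in> {s..t}" for r
    proof -
      have "\<bar>w t - w r\<bar> \<le> L * (t - s)"
        using lipw[of r t] r st L0 mult_left_mono[of "t - r" "t - s" L] by auto
      then have 1: "\<bar>w t - w r\<bar> * \<bar>g r\<bar> \<le> L * (t - s) * B"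
        using B[of r] r st L0 by (intro mult_mono) auto
      have "\<bar>G s - G r\<bar> \<le> B * (t - s)"
        using lipG[of s r] r st B0 mult_left_mono[of "r - s" "t - s" B] by auto
      then have 2: "\<bar>w' r\<bar> * \<bar>G s - G r\<bar> \<le> L * (B * (t - s))"
        using L[of r] r st L0 by (intro mult_mono) auto
      have "\<bar>(w t - w r) * g r + w' r * (G s - G r)\<bar>
          \<le> \<bar>w t - w r\<bar> * \<bar>g r\<bar> + \<bar>w' r\<bar> * \<bar>G s - G r\<bar>"
        by (metis abs_mult abs_triangle_ineq)
      with 1 2 show ?thesis by (simp add: algebra_simps)
    qed
    ultimately have "norm (h t - h s) \<le> 2 * L * B * (t - s) * Henstock_Kurzweil_Integration.content {s..t}"
      using st L0 B0 by (intro has_integral_bound_real[OF _ finite.emptyI]) auto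
    then show "\<bar>h t - h s\<bar> \<le> 2 * L * B * (t - s)\<^sup>2"
      using st by (simp add: power2_eq_square algebra_simps)
  qed
  moreover have "G a = c"
    using integral_unique[OF G[of a]] \<open>a \<le> b\<close> by auto
  ultimately have "integral {a..b} ?f = w b * G b - w a * c"
    by (simp add: h_def)
  with fint show ?thesis by (simp add: has_integral_iff)
qed

section \<open>Passage from bounded intervals to the half-line\<close>

text \<open>Dominated convergence is applied to the truncations of \<open>f\<close> to
  \<open>{a..a + k}\<close>. At each point they are eventually equal to \<open>f\<close>, and their
  integrals are values of \<open>F\<close> along a sequence tending to infinity.\<close>

lemma has_integral_dominated_to_inf:
  fixes f g F :: "real \<Rightarrow> real"
  assumes F: "\<And>T. a \<le> T \<Longrightarrow> (f has_integral F T) {a..T}"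
    and g: "g integrable_on {a..}"
    and le: "\<And>t. a \<le> t \<Longrightarrow> \<bar>f t\<bar> \<le> g t"
    and lim: "(F \<longlongrightarrow> l) at_top"
  shows "(f has_integral l) {a..}"
proof (rule has_integral_dominated_convergence)
  let ?T = "\<lambda>k. a + real k"
  show "((\<lambda>t. if t \<in> {a..?T k} then f t else 0) has_integral F (?T k)) {a..}" for k
    using F[of "?T k"] by (subst has_integral_restrict) auto
  show "\<forall>t\<in>{a..}. norm (if t \<in> {a..?T k} then f t else 0) \<le> g t" for k
    using le by (auto intro: order_trans[OF abs_ge_zero])
  show "\<forall>t\<in>{a..}. (\<lambda>k. if t \<in> {a..?T k} then f t else 0) \<longlonglongrightarrow> f t"
  proof
    fix t assume "t \<in> {a..}"
    have "eventually (\<lambda>k. (if t \<in> {a..?T k} then f t else 0) = f t) sequentially"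
      using eventually_ge_at_top[of "nat \<lceil>t - a\<rceil>"]
    proof eventually_elim
      case (elim k)
      then have "t \<le> ?T k" by linarith
      with \<open>t \<in> {a..}\<close> show ?case by simp
    qed
    then show "(\<lambda>k. if t \<in> {a..?T k} then f t else 0) \<longlonglongrightarrow> f t"
      by (rule tendsto_eventually)
  qed
  have "filterlim ?T at_top sequentially"
    by (intro filterlim_tendsto_add_at_top[OF tendsto_const] filterlim_real_sequentially)
  then show "(\<lambda>k. F (?T k)) \<longlonglongrightarrow> l"
    by (rule filterlim_compose[OF lim])
qed (rule g)

section \<open>Skill paths: continuity, weighted increments, invariance of the skill range\<close>

lemma admissible_continuous_on:
  assumes "admissible \<kappa> Sbar S0 u S"
  shows "continuous_on {0..T} S"
proof (cases "T \<ge> 0")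
  case True
  let ?d = "\<lambda>s. skill_drift \<kappa> Sbar (S s) (u s)"
  have int: "(?d has_integral (S t - S0)) {0..t}" if "t \<ge> 0" for t
    using assms that by (auto simp: admissible_def)
  have "continuous_on {0..T} (\<lambda>t. S0 + integral {0..t} ?d)"
    using int[OF True] by (intro continuous_intros indefinite_integral_continuous_1) auto
  moreover have "S0 + integral {0..t} ?d = S t" if "t \<in> {0..T}" for t
    using integral_unique[OF int[of t]] that by simp
  ultimately show ?thesis by (rule continuous_on_eq)
qed simp

text \<open>The weight \<open>exp (c * t)\<close> is used twice: \<open>c = \<kappa>\<close> is the
  integrating factor of the skill equation and \<open>c = - \<delta>\<close> is discounting.\<close>

lemma admissible_by_parts:
  assumes adm: "admissible \<kappa> Sbar S0 u S" and "T \<ge> 0"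
  shows "((\<lambda>t. exp (c * t) * skill_drift \<kappa> Sbar (S t) (u t) + c * exp (c * t) * S t)
    has_integral (exp (c * T) * S T - S0)) {0..T}"
proof -
  have u: "\<bar>u t\<bar> \<le> 1" if "t \<ge> 0" for t
    using adm that by (auto simp: admissible_def abs_le_iff)
  have "bounded (S ` {0..T})"
    using compact_continuous_image[OF admissible_continuous_on[OF adm]] compact_imp_bounded by auto
  then obtain M where M: "\<And>t. t \<in> {0..T} \<Longrightarrow> \<bar>S t\<bar> \<le> M"
    unfolding bounded_iff by (metis imageI real_norm_def)
  have "((\<lambda>t. exp (c * t) * skill_drift \<kappa> Sbar (S t) (u t) + (c * exp (c * t)) * S t)
    has_integral (exp (c * T) * S T - exp (c * 0) * S0)) {0..T}"
  \<comment> \<open>\<open>M\<close> comes only from continuity on a compact interval, because the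
    invariance of \<open>{0..Sbar}\<close> is itself derived from this lemma. The factor 2 is a
    crude bound for \<open>1 - u t\<close>.\<close>
  proof (rule has_integral_by_parts_indefinite[where B = "\<bar>\<kappa> * Sbar\<bar> * 2 + \<bar>\<kappa>\<bar> * M"])
    fix t assume t: "t \<in> {0..T}"
    show "((\<lambda>t. exp (c * t)) has_real_derivative c * exp (c * t)) (at t within {0..T})"
      by (auto intro!: derivative_eq_intros)
    show "((\<lambda>s. skill_drift \<kappa> Sbar (S s) (u s)) has_integral (S t - S0)) {0..t}"
      using adm t by (auto simp: admissible_def)
    have "\<bar>\<kappa> * Sbar * (1 - u t)\<bar> \<le> \<bar>\<kappa> * Sbar\<bar> * 2"
      unfolding abs_mult[of _ "1 - u t"] using u[of t] t by (intro mult_left_mono) auto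
    moreover have "\<bar>\<kappa> * S t\<bar> \<le> \<bar>\<kappa>\<bar> * M"
      unfolding abs_mult using M[OF t] by (intro mult_left_mono) auto
    ultimately show "\<bar>skill_drift \<kappa> Sbar (S t) (u t)\<bar> \<le> \<bar>\<kappa> * Sbar\<bar> * 2 + \<bar>\<kappa>\<bar> * M"
      unfolding skill_drift_def by linarith
  qed (use \<open>T \<ge> 0\<close> in \<open>auto intro!: continuous_intros\<close>)
  then show ?thesis by simp
qed

text \<open>The integrating factor \<open>exp (\<kappa> * t)\<close> cancels the skill from the
  drift. What remains is a nonnegative integrand in \<open>u\<close> alone, which gives the lower
  bound. It is largest at zero usage, which gives the upper bound.\<close>

lemma admissible_skill_in_range:
  assumes adm: "admissible \<kappa> Sbar S0 u S" and "\<kappa> \<ge> 0" "Sbar \<ge> 0" "S0 \<in> {0..Sbar}" "T \<ge> 0"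
  shows "S T \<in> {0..Sbar}"
proof -
  have u: "0 \<le> u t \<and> u t \<le> 1" if "t \<ge> 0" for t
    using adm that by (auto simp: admissible_def)
  have 1: "((\<lambda>t. exp (\<kappa> * t) * (\<kappa> * Sbar * (1 - u t))) has_integral (exp (\<kappa> * T) * S T - S0)) {0..T}"
    using admissible_by_parts[OF adm \<open>T \<ge> 0\<close>, of \<kappa>]
    by (simp add: skill_drift_def algebra_simps)
  then have "0 \<le> exp (\<kappa> * T) * S T - S0"
    by (rule has_integral_nonneg) (use assms(2,3) u in auto)
  then have "0 \<le> exp (\<kappa> * T) * S T" using \<open>S0 \<in> {0..Sbar}\<close> by auto
  then have ge: "0 \<le> S T" by (simp add: zero_le_mult_iff)
  \<comment> \<open>At zero usage the integrand is the exact derivative of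
    \<open>Sbar * exp (\<kappa> * t)\<close>.\<close>
  have "((\<lambda>t. Sbar * (\<kappa> * exp (\<kappa> * t))) has_integral (Sbar * exp (\<kappa> * T) - Sbar * exp (\<kappa> * 0))) {0..T}"
    using \<open>T \<ge> 0\<close>
    by (intro fundamental_theorem_of_calculus)
      (auto simp: has_real_derivative_iff_has_vector_derivative[symmetric] intro!: derivative_eq_intros)
  then have "exp (\<kappa> * T) * S T - S0 \<le> Sbar * exp (\<kappa> * T) - Sbar * exp (\<kappa> * 0)"
  proof (rule has_integral_le[OF 1])
    fix t assume "t \<in> {0..T}"
    then have "exp (\<kappa> * t) * (\<kappa> * Sbar * (1 - u t)) \<le> exp (\<kappa> * t) * (\<kappa> * Sbar * 1)"
      using u[of t] assms(2,3) by (intro mult_left_mono mult_nonneg_nonneg) auto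
    then show "exp (\<kappa> * t) * (\<kappa> * Sbar * (1 - u t)) \<le> Sbar * (\<kappa> * exp (\<kappa> * t))"
      by (simp add: algebra_simps)
  qed
  moreover have "Sbar * exp (\<kappa> * 0) \<ge> S0"
    using \<open>S0 \<in> {0..Sbar}\<close> by simp
  ultimately have "exp (\<kappa> * T) * S T \<le> exp (\<kappa> * T) * Sbar"
    unfolding mult.commute[of "exp (\<kappa> * T)" Sbar] by linarith
  with ge show ?thesis by simp
qed

section \<open>Discounted integrals and the payoff\<close>

lemma integral_exp_discount:
  fixes \<delta> :: real
  assumes "\<delta> > 0"
  shows "((\<lambda>t. exp (- \<delta> * t)) has_integral 1 / \<delta>) {0..}"
  using has_integral_exp_minus_to_infinity[OF assms, of 0] by simp

text \<open>The integrand is the derivative of the discounted skill. Since the skill stays in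
  \<open>{0..Sbar}\<close>, the boundary term at infinity vanishes and only the initial skill is
  left.\<close>

lemma admissible_discounted_drift:
  assumes adm: "admissible \<kappa> Sbar S0 u S" and pos: "\<kappa> \<ge> 0" "Sbar \<ge> 0" "S0 \<in> {0..Sbar}" "\<delta> > 0"
  shows "((\<lambda>t. exp (- \<delta> * t) * skill_drift \<kappa> Sbar (S t) (u t) + - \<delta> * exp (- \<delta> * t) * S t)
    has_integral - S0) {0..}"
proof (rule has_integral_dominated_to_inf)
  have S: "0 \<le> S t \<and> S t \<le> Sbar" if "t \<ge> 0" for t
    using admissible_skill_in_range[OF adm pos(1-3) that] by auto
  have u: "0 \<le> u t \<and> u t \<le> 1" if "t \<ge> 0" for t
    using adm that by (auto simp: admissible_def)
  show "((\<lambda>t. exp (- \<delta> * t) * skill_drift \<kappa> Sbar (S t) (u t) + - \<delta> * exp (- \<delta> * t) * S t)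
    has_integral (exp (- \<delta> * T) * S T - S0)) {0..T}" if "0 \<le> T" for T
    by (rule admissible_by_parts[OF adm that])
  show "(\<lambda>t. (\<kappa> * Sbar + \<delta> * Sbar) * exp (- \<delta> * t)) integrable_on {0..}"
    using has_integral_mult_right[OF integral_exp_discount[OF \<open>\<delta> > 0\<close>]] by blast
  show "\<bar>exp (- \<delta> * t) * skill_drift \<kappa> Sbar (S t) (u t) + - \<delta> * exp (- \<delta> * t) * S t\<bar>
      \<le> (\<kappa> * Sbar + \<delta> * Sbar) * exp (- \<delta> * t)" if "0 \<le> t" for t
  proof -
    have "0 \<le> \<kappa> * S t" "\<kappa> * S t \<le> \<kappa> * Sbar" "0 \<le> \<delta> * S t" "\<delta> * S t \<le> \<delta> * Sbar"
      "0 \<le> \<kappa> * Sbar * (1 - u t)" "\<kappa> * Sbar * (1 - u t) \<le> \<kappa> * Sbar * 1"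
      using S[OF that] u[OF that] pos by (auto intro!: mult_left_mono mult_left_le mult_nonneg_nonneg)
    then have "\<bar>skill_drift \<kappa> Sbar (S t) (u t) - \<delta> * S t\<bar> \<le> \<kappa> * Sbar + \<delta> * Sbar"
      unfolding skill_drift_def abs_le_iff by linarith
    then have "\<bar>exp (- \<delta> * t)\<bar> * \<bar>skill_drift \<kappa> Sbar (S t) (u t) - \<delta> * S t\<bar>
        \<le> exp (- \<delta> * t) * (\<kappa> * Sbar + \<delta> * Sbar)"
      by (simp add: mult_left_mono)
    then show ?thesis
      unfolding abs_mult[symmetric] by (simp add: algebra_simps)
  qed
  have disc: "((\<lambda>T. exp (- \<delta> * T)) \<longlongrightarrow> 0) at_top"
    using \<open>\<delta> > 0\<close>
    by (intro filterlim_compose[OF exp_at_bot] filterlim_tendsto_neg_mult_at_bot[OF tendsto_const]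
        filterlim_ident) auto
  have "((\<lambda>T. exp (- \<delta> * T) * S T) \<longlongrightarrow> 0) at_top"
  proof (rule Lim_null_comparison)
    show "\<forall>\<^sub>F T in at_top. norm (exp (- \<delta> * T) * S T) \<le> exp (- \<delta> * T) * Sbar"
      using eventually_ge_at_top[of 0] by eventually_elim (use S in \<open>auto simp: abs_mult\<close>)
    show "((\<lambda>T. exp (- \<delta> * T) * Sbar) \<longlongrightarrow> 0) at_top"
      using tendsto_mult_right[OF disc, of Sbar] by simp
  qed
  then show "((\<lambda>T. exp (- \<delta> * T) * S T - S0) \<longlongrightarrow> - S0) at_top"
    using tendsto_diff[OF _ tendsto_const, of _ 0 at_top S0] by simp
qed

lemma discounted_usage_gain_integrable:
  assumes adm: "admissible \<kappa> Sbar S0 u S" and "\<delta> > 0"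
  shows "(\<lambda>t. exp (- \<delta> * t) * (a * u t - b * (u t)\<^sup>2)) integrable_on {0..}"
proof (rule measurable_bounded_by_integrable_imp_integrable_real)
  have [measurable]: "u \<in> borel_measurable (lebesgue_on {0..})"
    using adm by (simp add: admissible_def)
  have [measurable]: "(\<lambda>t. exp (- \<delta> * t)) \<in> borel_measurable (lebesgue_on {0..})"
    by (intro continuous_imp_measurable_on_sets_lebesgue continuous_intros) auto
  show "(\<lambda>t. exp (- \<delta> * t) * (a * u t - b * (u t)\<^sup>2)) \<in> borel_measurable (lebesgue_on {0..})"
    by measurable
  show "(\<lambda>t. (\<bar>a\<bar> + \<bar>b\<bar>) * exp (- \<delta> * t)) integrable_on {0..}"
    using has_integral_mult_right[OF integral_exp_discount[OF \<open>\<delta> > 0\<close>]] by blast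
  show "\<bar>exp (- \<delta> * t) * (a * u t - b * (u t)\<^sup>2)\<bar> \<le> (\<bar>a\<bar> + \<bar>b\<bar>) * exp (- \<delta> * t)"
    if "t \<in> {0..}" for t
  proof -
    have u: "0 \<le> u t" "u t \<le> 1" using adm that by (auto simp: admissible_def)
    then have "\<bar>a\<bar> * \<bar>u t\<bar> \<le> \<bar>a\<bar> * 1" "\<bar>b\<bar> * \<bar>(u t)\<^sup>2\<bar> \<le> \<bar>b\<bar> * 1"
      by (auto intro!: mult_left_le simp: power_le_one)
    then have "\<bar>a * u t - b * (u t)\<^sup>2\<bar> \<le> \<bar>a\<bar> + \<bar>b\<bar>"
      using abs_triangle_ineq4[of "a * u t" "b * (u t)\<^sup>2"] unfolding abs_mult by linarith
    then show ?thesis by (simp add: abs_mult)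
  qed
qed auto

text \<open>The constant \<open>A = 1 / (\<delta> + \<kappa>)\<close> is the shadow price of skill.
  Subtracting \<open>A\<close> times the derivative of the discounted skill turns the remaining
  skill dependence into a term in the usage, which lowers the coefficient of \<open>u t\<close> from
  \<open>\<alpha>\<close> by \<open>\<kappa> * Sbar * A\<close>.\<close>

lemma payoff_decomposition:
  assumes adm: "admissible \<kappa> Sbar S0 u S"
    and pos: "\<kappa> \<ge> 0" "Sbar \<ge> 0" "S0 \<in> {0..Sbar}" "\<delta> > 0"
  shows "payoff \<alpha> 1 \<gamma> \<delta> u S = S0 / (\<delta> + \<kappa>) + \<kappa> * Sbar / (\<delta> * (\<delta> + \<kappa>)) +
    integral {0..} (\<lambda>t. exp (- \<delta> * t) * ((\<alpha> - \<kappa> * Sbar / (\<delta> + \<kappa>)) * u t - \<gamma> * (u t)\<^sup>2))"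
proof -
  define A where "A = 1 / (\<delta> + \<kappa>)"
  have A: "\<delta> * A + \<kappa> * A = 1" using pos by (simp add: A_def add_divide_distrib[symmetric])
  let ?d = "\<lambda>t. exp (- \<delta> * t) * skill_drift \<kappa> Sbar (S t) (u t) + - \<delta> * exp (- \<delta> * t) * S t"
  let ?g = "\<lambda>t. exp (- \<delta> * t) * ((\<alpha> - \<kappa> * Sbar * A) * u t - \<gamma> * (u t)\<^sup>2)"
  have "((\<lambda>t. (- A) * ?d t + (\<kappa> * Sbar * A) * exp (- \<delta> * t) + ?g t)
      has_integral ((- A) * (- S0) + (\<kappa> * Sbar * A) * (1 / \<delta>) + integral {0..} ?g)) {0..}"
    by (intro has_integral_add has_integral_mult_right admissible_discounted_drift[OF adm]
        integral_exp_discount integrable_integral discounted_usage_gain_integrable[OF adm] pos)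
  \<comment> \<open>Collecting terms gives the skill the coefficient
    \<open>\<delta> * A + \<kappa> * A\<close>, and \<open>A\<close> is chosen to make this
    1.\<close>
  moreover have "(- A) * ?d t + (\<kappa> * Sbar * A) * exp (- \<delta> * t) + ?g t =
      exp (- \<delta> * t) * productivity \<alpha> 1 \<gamma> (S t) (u t)" for t
  proof -
    have "(- A) * ?d t + (\<kappa> * Sbar * A) * exp (- \<delta> * t) + ?g t =
        exp (- \<delta> * t) * ((\<delta> * A + \<kappa> * A) * S t + \<alpha> * u t - \<gamma> * (u t)\<^sup>2)"
      by (simp add: skill_drift_def algebra_simps)
    also have "\<dots> = exp (- \<delta> * t) * productivity \<alpha> 1 \<gamma> (S t) (u t)"
      unfolding A by (simp add: productivity_def algebra_simps power2_eq_square)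
    finally show ?thesis .
  qed
  ultimately have "payoff \<alpha> 1 \<gamma> \<delta> u S =
      (- A) * (- S0) + (\<kappa> * Sbar * A) * (1 / \<delta>) + integral {0..} ?g"
    unfolding payoff_def by (simp add: integral_unique)
  then show ?thesis by (simp add: A_def algebra_simps)
qed

section \<open>Value function and optimal usage\<close>

lemma admissible_constant_usage:
  assumes "c \<in> {0..1}"
  shows "admissible \<kappa> Sbar S0 (\<lambda>t. c)
    (\<lambda>t. Sbar * (1 - c) + (S0 - Sbar * (1 - c)) * exp (- \<kappa> * t))" (is "admissible _ _ _ _ ?S")
  unfolding admissible_def
proof (intro conjI allI impI)
  fix t :: real assume "t \<ge> 0"
  have "((\<lambda>s. skill_drift \<kappa> Sbar (?S s) c) has_integral (?S t - ?S 0)) {0..t}"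
    using \<open>t \<ge> 0\<close>
    by (intro fundamental_theorem_of_calculus)
      (auto simp: has_real_derivative_iff_has_vector_derivative[symmetric] skill_drift_def
        algebra_simps intro!: derivative_eq_intros)
  then show "((\<lambda>s. skill_drift \<kappa> Sbar (?S s) c) has_integral (?S t - S0)) {0..t}"
    by simp
qed (use assms in auto)

text \<open>For \<open>a \<ge> 0\<close> this is completing the square, with equality. For
  \<open>a < 0\<close> the vertex is clipped to 0 and the linear term is nonpositive. The quadratic
  slack later yields uniqueness of the maximizer.\<close>

lemma clipped_vertex_maximizes_quadratic:
  fixes a \<gamma> :: real
  assumes "\<gamma> > 0" "v \<ge> 0"
  defines "m \<equiv> max 0 (a / (2 * \<gamma>))"
  shows "a * v - \<gamma> * v\<^sup>2 \<le> a * m - \<gamma> * m\<^sup>2 - \<gamma> * (v - m)\<^sup>2"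
proof (cases "a \<ge> 0")
  case True
  then have "a = 2 * \<gamma> * m" using assms by (simp add: m_def max_def field_simps)
  then show ?thesis by (simp add: algebra_simps power2_eq_square)
next
  case False
  then have "m = 0" using assms by (simp add: m_def max_def field_simps)
  moreover have "a * v \<le> 0" using False assms by (simp add: mult_nonpos_nonneg)
  ultimately show ?thesis by simp
qed

text \<open>Only the usage integral in the decomposed payoff depends on the control. Its integrand
  is bounded pointwise by the value at \<open>m\<close>, and the constant control \<open>m\<close>
  attains this bound, so the \<open>Sup\<close> is a maximum.\<close>

lemma value_fun_optimal_usage:
  fixes \<alpha> \<gamma> \<kappa> \<delta> Sbar S0 :: real
  assumes pos: "\<gamma> > 0" "\<kappa> \<ge> 0" "Sbar \<ge> 0" "\<delta> > 0" and S0: "S0 \<in> {0..Sbar}"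
  defines "a \<equiv> \<alpha> - \<kappa> * Sbar / (\<delta> + \<kappa>)"
  defines "m \<equiv> max 0 (a / (2 * \<gamma>))"
  assumes "m \<le> 1"
  shows "value_fun \<alpha> 1 \<gamma> \<kappa> \<delta> Sbar S0 =
      S0 / (\<delta> + \<kappa>) + \<kappa> * Sbar / (\<delta> * (\<delta> + \<kappa>)) + (a * m - \<gamma> * m\<^sup>2) / \<delta>" (is "_ = ?V")
    and "optimal_control \<alpha> 1 \<gamma> \<kappa> \<delta> Sbar S0 (\<lambda>t. m)"
proof -
  have disc: "((\<lambda>t. exp (- \<delta> * t) * (a * m - \<gamma> * m\<^sup>2)) has_integral (a * m - \<gamma> * m\<^sup>2) / \<delta>) {0..}"
    using has_integral_mult_left[OF integral_exp_discount[OF \<open>\<delta> > 0\<close>]] by simp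
  have le: "payoff \<alpha> 1 \<gamma> \<delta> u S \<le> ?V" if adm: "admissible \<kappa> Sbar S0 u S" for u S
  proof -
    have "integral {0..} (\<lambda>t. exp (- \<delta> * t) * (a * u t - \<gamma> * (u t)\<^sup>2)) \<le> (a * m - \<gamma> * m\<^sup>2) / \<delta>"
    proof (rule has_integral_le[OF integrable_integral disc])
      show "(\<lambda>t. exp (- \<delta> * t) * (a * u t - \<gamma> * (u t)\<^sup>2)) integrable_on {0..}"
        by (rule discounted_usage_gain_integrable[OF adm \<open>\<delta> > 0\<close>])
      fix t :: real assume "t \<in> {0..}"
      then have "u t \<ge> 0" using adm by (auto simp: admissible_def)
      then have "a * u t - \<gamma> * (u t)\<^sup>2 \<le> a * m - \<gamma> * m\<^sup>2 - \<gamma> * (u t - m)\<^sup>2"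
        unfolding m_def by (rule clipped_vertex_maximizes_quadratic[OF \<open>\<gamma> > 0\<close>])
      moreover have "0 \<le> \<gamma> * (u t - m)\<^sup>2" using \<open>\<gamma> > 0\<close> by simp
      ultimately show "exp (- \<delta> * t) * (a * u t - \<gamma> * (u t)\<^sup>2) \<le> exp (- \<delta> * t) * (a * m - \<gamma> * m\<^sup>2)"
        by (intro mult_left_mono) auto
    qed
    then show ?thesis
      using payoff_decomposition[OF adm pos(2,3) S0 pos(4)] by (simp add: a_def)
  qed
  have "m \<in> {0..1}" using \<open>m \<le> 1\<close> by (simp add: m_def)
  then obtain S where adm: "admissible \<kappa> Sbar S0 (\<lambda>t. m) S"
    using admissible_constant_usage by blast
  have eq: "payoff \<alpha> 1 \<gamma> \<delta> (\<lambda>t. m) S = ?V"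
    using payoff_decomposition[OF adm pos(2,3) S0 pos(4)] integral_unique[OF disc]
    by (simp add: a_def)
  show "value_fun \<alpha> 1 \<gamma> \<kappa> \<delta> Sbar S0 = ?V"
    unfolding value_fun_def using le adm eq[symmetric] by (intro cSup_eq_maximum) blast+
  show "optimal_control \<alpha> 1 \<gamma> \<kappa> \<delta> Sbar S0 (\<lambda>t. m)"
    unfolding optimal_control_def is_arg_max_def
    using adm le eq by (intro exI[of _ S]) (auto simp: not_less)
qed

section \<open>Bellman equation\<close>

text \<open>The value function is affine in skill with slope
  \<open>1 / (\<delta> + \<kappa>)\<close>. The Bellman maximand is therefore the quadratic
  \<open>a * v - \<gamma> * v\<^sup>2\<close> plus terms free of \<open>v\<close>, so its maximizer
  does not depend on the skill.\<close>

lemma bellman_usage_iff: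
  fixes \<alpha> \<gamma> \<kappa> \<delta> Sbar S u :: real
  assumes pos: "\<gamma> > 0" "\<kappa> \<ge> 0" "Sbar > 0" "\<delta> > 0" and S: "S \<in> {0..Sbar}"
  defines "a \<equiv> \<alpha> - \<kappa> * Sbar / (\<delta> + \<kappa>)"
  defines "m \<equiv> max 0 (a / (2 * \<gamma>))"
  assumes "m \<le> 1"
  shows "bellman_usage \<alpha> 1 \<gamma> \<kappa> \<delta> Sbar S u \<longleftrightarrow> u = m"
proof -
  define A where "A = 1 / (\<delta> + \<kappa>)"
  define K where "K = \<kappa> * Sbar / (\<delta> * (\<delta> + \<kappa>)) + (a * m - \<gamma> * m\<^sup>2) / \<delta>"
  let ?V = "value_fun \<alpha> 1 \<gamma> \<kappa> \<delta> Sbar"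
  let ?H = "\<lambda>v. productivity \<alpha> 1 \<gamma> S v + A * skill_drift \<kappa> Sbar S v"
  have A: "\<delta> * A + \<kappa> * A = 1" using pos by (simp add: A_def add_divide_distrib[symmetric])
  have a: "a = \<alpha> - \<kappa> * Sbar * A" by (simp add: a_def A_def)
  have V: "?V s = A * s + K" if "s \<in> {0..Sbar}" for s
    using value_fun_optimal_usage(1)[of \<gamma> \<kappa> Sbar \<delta> s \<alpha>] pos that \<open>m \<le> 1\<close>
    unfolding a_def m_def K_def A_def by (simp add: add.assoc)
  have "((\<lambda>s. A * s + K) has_real_derivative A) (at S within {0..Sbar})"
    by (auto intro!: derivative_eq_intros)
  then have deriv: "(?V has_real_derivative A) (at S within {0..Sbar})"
    by (rule has_field_derivative_transform_within[OF _ zero_less_one]) (use S V in auto)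
  \<comment> \<open>Even at an endpoint the derivative is unique, since \<open>Sbar > 0\<close>
    makes the interval nondegenerate.\<close>
  have uniq: "D = A" if "(?V has_real_derivative D) (at S within {0..Sbar})" for D
    using vector_derivative_unique_within_closed_interval[of 0 Sbar S ?V D A] that deriv pos S
    by (simp add: has_real_derivative_iff_has_vector_derivative)
  \<comment> \<open>The coefficient 1 of \<open>S\<close> is written as
    \<open>\<delta> * A + \<kappa> * A\<close>, so that the skill terms reduce to
    \<open>\<delta> * A * S\<close> and match \<open>\<delta> * ?V S\<close>.\<close>
  have H: "?H v = (\<delta> * A + \<kappa> * A) * S - \<kappa> * A * S + \<kappa> * Sbar * A + (a * v - \<gamma> * v\<^sup>2)" for v
    unfolding A unfolding a productivity_def skill_drift_def
    by (simp add: algebra_simps power2_eq_square)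
  have m: "m \<in> {0..1}" using \<open>m \<le> 1\<close> by (simp add: m_def)
  have less: "?H v \<le> ?H m - \<gamma> * (v - m)\<^sup>2" if "v \<in> {0..1}" for v
    using clipped_vertex_maximizes_quadratic[of \<gamma> v a] pos that unfolding H m_def by simp
  have argmax: "is_arg_max ?H (\<lambda>v. v \<in> {0..1}) m"
  proof -
    have "?H v \<le> ?H m" if "v \<in> {0..1}" for v
    proof -
      have "0 \<le> \<gamma> * (v - m)\<^sup>2" using pos by simp
      with less[OF that] show ?thesis by linarith
    qed
    then show ?thesis using m by (auto simp: is_arg_max_def not_less)
  qed
  have unique_argmax: "u = m" if u: "is_arg_max ?H (\<lambda>v. v \<in> {0..1}) u"
  proof -
    have "?H m \<le> ?H u" using u m by (auto simp: is_arg_max_def not_less)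
    moreover have "?H u \<le> ?H m - \<gamma> * (u - m)\<^sup>2"
      using u by (intro less) (auto simp: is_arg_max_def)
    ultimately have "\<gamma> * (u - m)\<^sup>2 \<le> 0" by linarith
    then have "(u - m)\<^sup>2 \<le> 0" using pos by (simp add: mult_le_0_iff)
    then show "u = m" by simp
  qed
  have "\<delta> * K = \<kappa> * Sbar * A + (a * m - \<gamma> * m\<^sup>2)"
    using pos unfolding K_def A_def by (subst distrib_left) simp
  then have "\<delta> * ?V S = ?H m"
    unfolding H V[OF S] by (simp add: algebra_simps)
  then have "bellman_usage \<alpha> 1 \<gamma> \<kappa> \<delta> Sbar S m"
    unfolding bellman_usage_def using deriv argmax by blast
  moreover have "u = m" if "bellman_usage \<alpha> 1 \<gamma> \<kappa> \<delta> Sbar S u"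
    using that uniq unique_argmax unfolding bellman_usage_def by blast
  ultimately show ?thesis by blast
qed

section \<open>Steady-state value and comparison with the benchmark\<close>

lemma steady_state_value:
  fixes \<alpha> \<gamma> \<kappa> \<delta> Sbar :: real
  assumes pos: "\<gamma> > 0" "\<kappa> \<ge> 0" "Sbar \<ge> 0" "\<delta> > 0"
  defines "a \<equiv> \<alpha> - \<kappa> * Sbar / (\<delta> + \<kappa>)"
  defines "m \<equiv> max 0 (a / (2 * \<gamma>))"
  assumes "m \<le> 1"
  shows "value_fun \<alpha> 1 \<gamma> \<kappa> \<delta> Sbar (Sbar * (1 - m)) =
    Sbar / \<delta> + m / (2 * \<delta>) * (\<alpha> - (2 * \<delta> + \<kappa>) * Sbar / (\<delta> + \<kappa>))"
proof -
  have "Sbar * (1 - m) \<in> {0..Sbar}"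
    using pos \<open>m \<le> 1\<close> by (auto simp: m_def intro!: mult_left_le)
  then have V: "value_fun \<alpha> 1 \<gamma> \<kappa> \<delta> Sbar (Sbar * (1 - m)) =
      Sbar * (1 - m) / (\<delta> + \<kappa>) + \<kappa> * Sbar / (\<delta> * (\<delta> + \<kappa>)) + (a * m - \<gamma> * m\<^sup>2) / \<delta>"
    using value_fun_optimal_usage(1)[of \<gamma> \<kappa> Sbar \<delta> "Sbar * (1 - m)" \<alpha>] pos \<open>m \<le> 1\<close>
    unfolding a_def m_def by blast
  \<comment> \<open>Either there is no usage or the first-order condition holds. In both cases the
    quadratic cost is half of the linear gain, so the excess over \<open>Sbar / \<delta>\<close> has
    the factor \<open>m\<close>, with coefficient
    \<open>a / (2 * \<delta>) - Sbar / (\<delta> + \<kappa>)\<close>.\<close>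
  have "m = 0 \<or> a = 2 * \<gamma> * m"
    using pos by (auto simp: m_def max_def)
  then have gain: "a * m - \<gamma> * m\<^sup>2 = a * m / 2"
    by (elim disjE) (simp_all add: power2_eq_square)
  have "\<delta> + \<kappa> > 0" using pos by simp
  then show ?thesis
    unfolding V gain unfolding a_def using pos by (simp add: divide_simps) (simp add: algebra_simps)
qed

theorem proposition1:
  fixes \<alpha> \<beta> \<gamma> \<kappa> \<delta> Sbar \<alpha>0 \<alpha>1 \<alpha>2 :: real and V :: "real \<Rightarrow> real"
  assumes "\<alpha> > 0" and "\<gamma> > 0" and "\<kappa> > 0" and "\<delta> > 0" and "Sbar > 0"
    and "\<beta> = 1"
    and "\<alpha>0 = \<kappa> * Sbar / (\<delta> + \<kappa>)"
    and "\<alpha>1 = (2 * \<delta> + \<kappa>) * Sbar / (\<delta> + \<kappa>)"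
    and "\<alpha>2 = 2 * \<gamma> + \<kappa> * Sbar / (\<delta> + \<kappa>)"
    and "\<alpha> < \<alpha>2"
    and "V = value_fun \<alpha> \<beta> \<gamma> \<kappa> \<delta> Sbar"
  shows "\<exists>ustar Shat.
    (\<forall>S\<in>{0..Sbar}. \<forall>u. bellman_usage \<alpha> \<beta> \<gamma> \<kappa> \<delta> Sbar S u \<longleftrightarrow> u = ustar) \<and>
    (\<forall>S0\<in>{0..Sbar}. optimal_control \<alpha> \<beta> \<gamma> \<kappa> \<delta> Sbar S0 (\<lambda>t. ustar)) \<and>
    ustar < 1 \<and>
    Shat = Sbar * (1 - ustar) \<and>
    (\<alpha> \<le> \<alpha>0 \<longrightarrow> ustar = 0 \<and> V Shat = Sbar / \<delta>) \<and>
    (\<alpha>0 < \<alpha> \<and> \<alpha> < \<alpha>1 \<longrightarrow>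
       0 < ustar \<and> ustar < 1 \<and>
       (\<forall>S\<in>{0..Sbar}. productivity \<alpha> \<beta> \<gamma> S ustar > productivity \<alpha> \<beta> \<gamma> S 0) \<and>
       V Shat < Sbar / \<delta>) \<and>
    (\<alpha> = \<alpha>1 \<longrightarrow> 0 < ustar \<and> V Shat = Sbar / \<delta>) \<and>
    (\<alpha> > \<alpha>1 \<longrightarrow>
       0 < ustar \<and> ustar < 1 \<and>
       (\<forall>S\<in>{0..Sbar}. productivity \<alpha> \<beta> \<gamma> S ustar > productivity \<alpha> \<beta> \<gamma> S 0) \<and>
       V Shat > Sbar / \<delta>)"
proof -
  define a where "a = \<alpha> - \<kappa> * Sbar / (\<delta> + \<kappa>)"
  define m where "m = max 0 (a / (2 * \<gamma>))"
  note pos = \<open>\<gamma> > 0\<close> less_imp_le[OF \<open>\<kappa> > 0\<close>] \<open>Sbar > 0\<close> \<open>\<delta> > 0\<close>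
  \<comment> \<open>Since \<open>a = \<alpha> - \<alpha>0\<close>, the hypothesis
    \<open>\<alpha> < \<alpha>2\<close> says exactly that the vertex lies below 1.\<close>
  have "a / (2 * \<gamma>) < 1" using assms by (simp add: a_def)
  then have m: "0 \<le> m" "m < 1" by (auto simp: m_def)
  have adopt: "0 < m" if "\<alpha>0 < \<alpha>"
    using that assms by (simp add: m_def a_def less_max_iff_disj)
  have no_adopt: "m = 0" if "\<alpha> \<le> \<alpha>0"
    using that assms by (simp add: m_def a_def max_absorb1 divide_le_0_iff)
  have V: "V (Sbar * (1 - m)) = Sbar / \<delta> + m / (2 * \<delta>) * (\<alpha> - \<alpha>1)"
    using steady_state_value[of \<gamma> \<kappa> Sbar \<delta> \<alpha>] assms(1-9,11) m
    unfolding a_def m_def by simp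
  \<comment> \<open>This ensures that usage is already positive at and above the break-even point
    \<open>\<alpha>1\<close>.\<close>
  have "\<alpha>0 < \<alpha>1"
    unfolding assms using \<open>\<kappa> > 0\<close> \<open>\<delta> > 0\<close> \<open>Sbar > 0\<close> by (intro divide_strict_right_mono) auto
  \<comment> \<open>The gain in current output is \<open>(\<alpha> - \<gamma> * m) * m\<close> at
    every skill. The first-order condition gives \<open>2 * \<gamma> * m = a \<le> \<alpha>\<close>,
    so the optimum stops at no more than half of the usage \<open>\<alpha> / \<gamma>\<close> at
    which this gain vanishes.\<close>
  have prod: "productivity \<alpha> \<beta> \<gamma> S m > productivity \<alpha> \<beta> \<gamma> S 0" if "0 < m" for S
  proof -
    have "2 * \<gamma> * m = a" using that \<open>\<gamma> > 0\<close> by (auto simp: m_def max_def split: if_splits)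
    moreover have "a \<le> \<alpha>" using assms by (simp add: a_def)
    ultimately have "\<gamma> * m < \<alpha>" using that \<open>\<gamma> > 0\<close> \<open>\<alpha> > 0\<close> by linarith
    then have "0 < (\<alpha> - \<gamma> * m) * m" using that by simp
    then show ?thesis using \<open>\<beta> = 1\<close> by (simp add: productivity_def algebra_simps)
  qed
  have coeff: "0 < m / (2 * \<delta>)" if "0 < m" using that \<open>\<delta> > 0\<close> by simp
  show ?thesis
  proof (rule exI[of _ m], rule exI[of _ "Sbar * (1 - m)"], intro conjI)
    show "\<forall>S\<in>{0..Sbar}. \<forall>u. bellman_usage \<alpha> \<beta> \<gamma> \<kappa> \<delta> Sbar S u \<longleftrightarrow> u = m"
      using bellman_usage_iff[OF pos] m \<open>\<beta> = 1\<close> unfolding a_def m_def by simp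
    show "\<forall>S0\<in>{0..Sbar}. optimal_control \<alpha> \<beta> \<gamma> \<kappa> \<delta> Sbar S0 (\<lambda>t. m)"
      using value_fun_optimal_usage(2)[of \<gamma> \<kappa> Sbar \<delta> _ \<alpha>] pos m \<open>\<beta> = 1\<close>
      unfolding a_def m_def by simp
    show "\<alpha> \<le> \<alpha>0 \<longrightarrow> m = 0 \<and> V (Sbar * (1 - m)) = Sbar / \<delta>"
      using no_adopt V by auto
    show "\<alpha>0 < \<alpha> \<and> \<alpha> < \<alpha>1 \<longrightarrow> 0 < m \<and> m < 1 \<and>
       (\<forall>S\<in>{0..Sbar}. productivity \<alpha> \<beta> \<gamma> S m > productivity \<alpha> \<beta> \<gamma> S 0) \<and>
       V (Sbar * (1 - m)) < Sbar / \<delta>"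
    proof (intro impI conjI ballI)
      assume *: "\<alpha>0 < \<alpha> \<and> \<alpha> < \<alpha>1"
      then show "0 < m" using adopt by simp
      then show "productivity \<alpha> \<beta> \<gamma> S m > productivity \<alpha> \<beta> \<gamma> S 0" for S by (rule prod)
      have "m / (2 * \<delta>) * (\<alpha> - \<alpha>1) < 0"
        using * coeff[OF \<open>0 < m\<close>] by (intro mult_pos_neg) auto
      then show "V (Sbar * (1 - m)) < Sbar / \<delta>" unfolding V by linarith
    qed (rule m)
    show "\<alpha> = \<alpha>1 \<longrightarrow> 0 < m \<and> V (Sbar * (1 - m)) = Sbar / \<delta>"
      using adopt \<open>\<alpha>0 < \<alpha>1\<close> V by simp
    show "\<alpha> > \<alpha>1 \<longrightarrow> 0 < m \<and> m < 1 \<and>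
       (\<forall>S\<in>{0..Sbar}. productivity \<alpha> \<beta> \<gamma> S m > productivity \<alpha> \<beta> \<gamma> S 0) \<and>
       V (Sbar * (1 - m)) > Sbar / \<delta>"
    proof (intro impI conjI ballI)
      assume *: "\<alpha> > \<alpha>1"
      then show "0 < m" using adopt \<open>\<alpha>0 < \<alpha>1\<close> by simp
      then show "productivity \<alpha> \<beta> \<gamma> S m > productivity \<alpha> \<beta> \<gamma> S 0" for S by (rule prod)
      have "m / (2 * \<delta>) * (\<alpha> - \<alpha>1) > 0"
        using * coeff[OF \<open>0 < m\<close>] by (intro mult_pos_pos) auto
      then show "V (Sbar * (1 - m)) > Sbar / \<delta>" unfolding V by linarith
    qed (rule m)
  qed (rule m refl)+
qed

end
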